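(* Let $F$ be a field of characteristic not $2$, let $(V,B)$ be a finite-dimensional symplectic vector space over $F$, and let $l_1,\ldots,l_n$ ($n\ge 2$) be Lagrangian subspaces of $V$. Identify the spaces $K_{1,2,\ldots,n}$, $K_{2,3,\ldots,n,1}$ and $K_{n,n-1,\ldots,1}$ by the obvious permutations of the summands $l_i$. Under these identifications, $$q_{2,3,\ldots,n,1}=q_{1,2,\ldots,n}=-q_{n,n-1,\ldots,1}.$$
   Context: For any finite sequence of Lagrangians $m_1,\ldots,m_n$ in $V$, indexed cyclically by $\mathbb Z/n\mathbb Z$, one defines a space $K$ and a bilinear form $q$ as follows. $K=\{w\in\bigoplus_{i\in\mathbb Z/n\mathbb Z} m_i:\sum_i w_i=0\}$. For $w\in K$ an anti-derivative is a family $\hat w=(\hat w_{\{i,i+1\}})_{i\in\mathbb Z/n\mathbb Z}$ of elements of $V$ (one for each $i$) with $\hat w_{\{i,i+1\}}-\hat w_{\{i-1,i\}}=w_i$ for all $i$; it exists and is unique up to adding a constant vector of $V$. Then $q(v,w)=\sum_{i\in\mathbb Z/n\mathbb Z}B(v_i,\hat w_{\{i,i+1\}})$, independent of the choice of $\hat w$. $K_{a_1,\ldots,a_n}$ and $q_{a_1,\ldots,a_n}$ denote the space and form obtained from the sequence $(m_1,\ldots,m_n)=(l_{a_1},\ldots,l_{a_n})$. *)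

theory Defs
  imports Complex_Main
begin

locale symplectic_vector_space = vector_space scl
  for scl :: "'f::field \<Rightarrow> 'v::ab_group_add \<Rightarrow> 'v" +
  fixes B :: "'v \<Rightarrow> 'v \<Rightarrow> 'f"
  assumes finite_dimensional: "\<exists>A. finite A \<and> span A = UNIV"
    and linear_left: "\<And>y. Vector_Spaces.linear scl (*) (\<lambda>x. B x y)"
    and linear_right: "\<And>x. Vector_Spaces.linear scl (*) (\<lambda>y. B x y)"
    and alternating: "\<And>x. B x x = 0"
    and nondegenerate: "\<And>x. (\<And>y. B x y = 0) \<Longrightarrow> x = 0"

definition lagrangian ::
    "('f::field \<Rightarrow> 'v::ab_group_add \<Rightarrow> 'v) \<Rightarrow> ('v \<Rightarrow> 'v \<Rightarrow> 'f) \<Rightarrow> 'v set \<Rightarrow> bool" where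
  "lagrangian scl B L \<longleftrightarrow> module.subspace scl L \<and> L = {x. \<forall>y\<in>L. B x y = 0}"

text \<open>
  A cyclic family indexed by \<open>\<int>/n\<int>\<close> is encoded as a list of length \<open>n\<close>, with indices taken
  modulo \<open>n\<close>. In particular an element of \<open>m\<^sub>1 \<oplus> \<dots> \<oplus> m\<^sub>n\<close> is a list of vectors,
  whose entry in each position lies in the subspace at that position.
\<close>

definition Kspace :: "'v::ab_group_add set list \<Rightarrow> 'v list set" where
  "Kspace ms = {w. length w = length ms \<and> (\<forall>i<length ms. w ! i \<in> ms ! i) \<and>
                   (\<Sum>i<length ms. w ! i) = 0}"

text \<open>
  The entry \<open>wh ! i\<close> stands for the component of the anti-derivative at \<open>{i, i+1}\<close>; the position
  \<open>(i + n - 1) mod n\<close> is the cyclic predecessor of \<open>i\<close>.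
\<close>

definition antiderivative :: "'v::ab_group_add list \<Rightarrow> 'v list \<Rightarrow> bool" where
  "antiderivative w wh \<longleftrightarrow> length wh = length w \<and>
     (\<forall>i<length w. wh ! i - wh ! ((i + length w - 1) mod length w) = w ! i)"

text \<open>
  The formula for the form does not mention the subspaces; the form attached to \<open>ms\<close> is
  \<open>qform B\<close> on \<open>Kspace ms\<close>. By \<open>qform_eq\<close> below, the choice of anti-derivative is immaterial there.
\<close>

definition qform :: "('v::ab_group_add \<Rightarrow> 'v \<Rightarrow> 'f::field) \<Rightarrow> 'v list \<Rightarrow> 'v list \<Rightarrow> 'f" where
  "qform B v w = (let wh = (SOME wh. antiderivative w wh) in \<Sum>i<length w. B (v ! i) (wh ! i))"

lemma antiderivative_exists:
  assumes "w \<in> Kspace ms"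
  shows "\<exists>wh. antiderivative w wh"
proof -
  let ?n = "length w"
  let ?h = "map (\<lambda>i. \<Sum>j\<le>i. w ! j) [0..<?n]"
  have sum0: "(\<Sum>i<?n. w ! i) = 0"
    using assms by (simp add: Kspace_def)
  have "?h ! i - ?h ! ((i + ?n - 1) mod ?n) = w ! i" if i: "i < ?n" for i
  proof (cases i)
    case 0
    then have "?h ! ((i + ?n - 1) mod ?n) = (\<Sum>j\<le>?n - 1. w ! j)"
      using i by simp
    also have "{..?n - 1} = {..<?n}"
      using i by auto
    finally show ?thesis
      using 0 i sum0 by simp
  next
    case (Suc k)
    then have "(i + ?n - 1) mod ?n = k"
      using i by simp
    then show ?thesis
      using Suc i by simp
  qed
  then have "antiderivative w ?h"
    by (simp add: antiderivative_def)
  then show ?thesis ..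
qed

lemma antiderivative_unique:
  assumes "antiderivative w wh" "antiderivative w wh'"
  shows "\<exists>c. \<forall>i<length w. wh' ! i = wh ! i + c"
proof -
  let ?n = "length w"
  have "wh' ! i = wh ! i + (wh' ! 0 - wh ! 0)" if "i < ?n" for i
    using that
  proof (induction i)
    case 0
    then show ?case by simp
  next
    case (Suc k)
    have k: "(Suc k + ?n - 1) mod ?n = k"
      using Suc.prems by simp
    have *: "h ! Suc k = h ! k + w ! Suc k" if "antiderivative w h" for h
    proof -
      have "h ! Suc k - h ! ((Suc k + ?n - 1) mod ?n) = w ! Suc k"
        using that Suc.prems unfolding antiderivative_def by blast
      then show ?thesis
        unfolding k by (simp add: diff_eq_eq add.commute)
    qed
    have "wh' ! k = wh ! k + (wh' ! 0 - wh ! 0)"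
      using Suc by simp
    then show ?case
      by (simp add: *[OF assms(1)] *[OF assms(2)] algebra_simps)
  qed
  then show ?thesis by blast
qed

lemma (in symplectic_vector_space) qform_eq:
  assumes v: "v \<in> Kspace ms" and w: "w \<in> Kspace ms" and wh: "antiderivative w wh"
  shows "qform B v w = (\<Sum>i<length ms. B (v ! i) (wh ! i))"
proof -
  define h where "h = (SOME wh. antiderivative w wh)"
  have "antiderivative w h"
    unfolding h_def using wh by (rule someI)
  then obtain c where c: "\<And>i. i < length w \<Longrightarrow> h ! i = wh ! i + c"
    using antiderivative_unique[OF wh] by blast
  have len: "length w = length ms" and sum0: "(\<Sum>i<length ms. v ! i) = 0"
    using v w by (auto simp: Kspace_def)
  interpret R: Vector_Spaces.linear scl "(*)" "\<lambda>y. B x y" for x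
    by (rule linear_right)
  interpret L: Vector_Spaces.linear scl "(*)" "\<lambda>x. B x c"
    by (rule linear_left)
  have "qform B v w = (\<Sum>i<length ms. B (v ! i) (wh ! i) + B (v ! i) c)"
    unfolding qform_def Let_def h_def[symmetric] len by (intro sum.cong) (auto simp: c len R.add)
  also have "\<dots> = (\<Sum>i<length ms. B (v ! i) (wh ! i)) + B (\<Sum>i<length ms. v ! i) c"
    by (simp add: sum.distrib L.sum)
  finally show ?thesis
    by (simp add: sum0 L.zero)
qed

end

theory Submission
  imports Defs
begin

text \<open>
  Everything rests on how anti-derivatives transform; since the form may be computed from any
  anti-derivative (\<open>qform_eq\<close>), it is enough to transport one.

  A rotation of the indices carries the edge \<open>{i, i+1}\<close> to an edge and keeps its direction, so
  the rotation of an anti-derivative of \<open>w\<close> is an anti-derivative of the rotation of \<open>w\<close>, and the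
  two sums defining the form have the same terms.

  A reversal also turns every edge around, so that the anti-derivative changes sign and the
  vertex \<open>i\<close>, which was paired with the edge \<open>{i, i+1}\<close> after it, is now paired with the edge
  \<open>{i-1, i}\<close> before it. For an anti-derivative \<open>h\<close> of \<open>w\<close>, the form of the reversed data is therefore
  minus the sum over \<open>i\<close> of the pairing of \<open>v\<^sub>i\<close> with the value of \<open>h\<close> on the edge before \<open>i\<close>. The values of \<open>h\<close> on the
  two edges at \<open>i\<close> differ by \<open>w\<^sub>i\<close>, and \<open>B (v\<^sub>i) (w\<^sub>i) = 0\<close> because \<open>v\<^sub>i\<close> and \<open>w\<^sub>i\<close> lie in the same
  isotropic subspace; so this is minus the original form.
\<close>

lemma Kspace_iff_list_all2: "w \<in> Kspace ms \<longleftrightarrow> list_all2 (\<in>) w ms \<and> sum_list w = 0"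
  by (auto simp: Kspace_def list_all2_conv_all_nth sum_list_sum_nth atLeast0LessThan)

lemma list_all2_rotate1_iff: "list_all2 P (rotate1 xs) (rotate1 ys) \<longleftrightarrow> list_all2 P xs ys"
proof (cases "length xs = length ys")
  case True
  then show ?thesis
    by (cases xs; cases ys) (auto simp: list_all2_append)
next
  case False
  then show ?thesis
    by (auto dest: list_all2_lengthD)
qed

lemma sum_list_rotate1: "sum_list (rotate1 xs) = (sum_list xs :: 'a::comm_monoid_add)"
  by (cases xs) (auto simp: add.commute)

lemma rotate1_in_Kspace_iff: "rotate1 w \<in> Kspace (rotate1 ms) \<longleftrightarrow> w \<in> Kspace ms"
  by (simp add: Kspace_iff_list_all2 list_all2_rotate1_iff sum_list_rotate1)

lemma rev_in_Kspace_iff: "rev w \<in> Kspace (rev ms) \<longleftrightarrow> w \<in> Kspace ms"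
  by (simp add: Kspace_iff_list_all2 sum_list_rev)

lemma bij_betw_rotate1_Kspace: "bij_betw rotate1 (Kspace ms) (Kspace (rotate1 ms))"
proof (rule bij_betw_imageI)
  show "inj_on rotate1 (Kspace ms)"
    using inj_rotate1 by (rule inj_on_subset) simp
  have "w \<in> rotate1 ` Kspace ms" if "w \<in> Kspace (rotate1 ms)" for w
    using that surjD[OF surj_rotate1, of w] by (auto simp: rotate1_in_Kspace_iff)
  then show "rotate1 ` Kspace ms = Kspace (rotate1 ms)"
    by (auto simp: rotate1_in_Kspace_iff)
qed

lemma bij_betw_rev_Kspace: "bij_betw rev (Kspace ms) (Kspace (rev ms))"
proof (rule bij_betw_byWitness[where f' = rev])
  show "rev ` Kspace (rev ms) \<subseteq> Kspace ms"
    using rev_in_Kspace_iff[of _ "rev ms"] by auto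
qed (auto simp: rev_in_Kspace_iff)

lemma sum_cyclic_shift:
  fixes f :: "nat \<Rightarrow> 'a::comm_monoid_add"
  shows "(\<Sum>i<n. f (Suc i mod n)) = (\<Sum>i<n. f i)"
proof (cases n)
  case (Suc m)
  have "(\<Sum>i<m. f (Suc i mod Suc m)) = (\<Sum>i<m. f (Suc i))"
    by (intro sum.cong) auto
  then show ?thesis
    unfolding Suc by (subst sum.lessThan_Suc, subst sum.lessThan_Suc_shift) (simp add: add.commute)
qed simp

lemma cyclic_pred_less: "(i + n - 1) mod n < n" if "i < n" for i n :: nat
  using that by simp

lemma Suc_cyclic_pred: "Suc ((i + n - 1) mod n) mod n = i" if "i < n" for i n :: nat
  using that by (simp add: mod_Suc_eq)

lemma cyclic_pred_Suc: "(Suc i mod n + n - 1) mod n = i" if "i < n" for i n :: nat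
proof (cases "Suc i = n")
  case False
  then show ?thesis using that by simp
qed auto

text \<open>
  In \<open>rotate1 g\<close> the entry of \<open>g\<close> at \<open>i\<close> belongs to the edge that ends at the vertex \<open>i\<close>. Seen from
  this side the defining equation has no predecessor of an index, and reversal exchanges \<open>g\<close> and
  \<open>rotate1 g\<close> up to sign.
\<close>

lemma antiderivative_rotate1_right_iff:
  "antiderivative w (rotate1 g) \<longleftrightarrow>
     length g = length w \<and> (\<forall>i<length w. g ! (Suc i mod length w) - g ! i = w ! i)"
proof (cases "length g = length w")
  case True
  have "rotate1 g ! ((i + length w - 1) mod length w) = g ! i" if "i < length w" for i
    using that by (simp only: nth_rotate1 True cyclic_pred_less Suc_cyclic_pred)
  then show ?thesis
    by (simp add: antiderivative_def nth_rotate1 True)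
qed (simp add: antiderivative_def)

lemma antiderivative_rotate1:
  assumes "antiderivative w h"
  shows "antiderivative (rotate1 w) (rotate1 h)"
  unfolding antiderivative_rotate1_right_iff
proof (intro conjI allI impI)
  show "length h = length (rotate1 w)"
    using assms by (simp add: antiderivative_def)
  fix i
  assume "i < length (rotate1 w)"
  then have i: "i < length w"
    by simp
  then have "Suc i mod length w < length w"
    by (intro mod_less_divisor) auto
  then have "h ! (Suc i mod length w) - h ! ((Suc i mod length w + length w - 1) mod length w) =
      w ! (Suc i mod length w)"
    using assms unfolding antiderivative_def by blast
  then show "h ! (Suc i mod length (rotate1 w)) - h ! i = rotate1 w ! i"
    using i by (simp only: cyclic_pred_Suc length_rotate1 nth_rotate1)
qed

lemma antiderivative_rev:
  assumes "antiderivative w (rotate1 g)"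
  shows "antiderivative (rev w) (rev (map uminus g))"
  unfolding antiderivative_def
proof (intro conjI allI impI)
  let ?n = "length w"
  have g: "length g = ?n" and diff: "\<And>i. i < ?n \<Longrightarrow> g ! (Suc i mod ?n) - g ! i = w ! i"
    using assms by (auto simp: antiderivative_rotate1_right_iff)
  show "length (rev (map uminus g)) = length (rev w)"
    by (simp add: g)
  fix i
  assume "i < length (rev w)"
  then have i: "i < ?n"
    by simp
  \<comment> \<open>Reflecting the cycle turns the predecessor of an index into the successor of its image.\<close>
  have "?n - Suc ((i + ?n - 1) mod ?n) = Suc (?n - Suc i) mod ?n"
    using i by (cases i) (auto simp: Suc_diff_Suc)
  then show "rev (map uminus g) ! i - rev (map uminus g) ! ((i + length (rev w) - 1) mod length (rev w))
      = rev w ! i"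
    using i diff[of "?n - Suc i"] cyclic_pred_less[OF i]
    by (simp add: g rev_nth del: One_nat_def)
qed

lemma lagrangian_isotropic: "lagrangian scl B L \<Longrightarrow> x \<in> L \<Longrightarrow> y \<in> L \<Longrightarrow> B x y = 0"
  unfolding lagrangian_def by blast

context symplectic_vector_space
begin

lemma qform_rotate1:
  assumes v: "v \<in> Kspace ms" and w: "w \<in> Kspace ms"
  shows "qform B (rotate1 v) (rotate1 w) = qform B v w"
proof -
  let ?n = "length ms"
  obtain h where h: "antiderivative w h"
    using antiderivative_exists[OF w] by blast
  have len: "length v = ?n" "length h = ?n"
    using v w h by (auto simp: Kspace_def antiderivative_def)
  have "qform B (rotate1 v) (rotate1 w) = (\<Sum>i<?n. B (rotate1 v ! i) (rotate1 h ! i))"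
    using qform_eq[of "rotate1 v" "rotate1 ms"] v w antiderivative_rotate1[OF h]
    by (simp add: rotate1_in_Kspace_iff)
  also have "\<dots> = (\<Sum>i<?n. B (v ! (Suc i mod ?n)) (h ! (Suc i mod ?n)))"
    by (simp add: nth_rotate1 len)
  also have "\<dots> = (\<Sum>i<?n. B (v ! i) (h ! i))"
    by (rule sum_cyclic_shift)
  also have "\<dots> = qform B v w"
    using qform_eq[OF v w h] by simp
  finally show ?thesis .
qed

text \<open>
  Isotropy makes the pairing of \<open>v\<^sub>i\<close> with the edge before
  \<open>i\<close> equal to its pairing with the edge after \<open>i\<close>.
\<close>

lemma qform_rev:
  assumes v: "v \<in> Kspace ms" and w: "w \<in> Kspace ms"
    and isotropic: "\<And>L x y. L \<in> set ms \<Longrightarrow> x \<in> L \<Longrightarrow> y \<in> L \<Longrightarrow> B x y = 0"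
  shows "qform B (rev v) (rev w) = - qform B v w"
proof -
  let ?n = "length ms"
  interpret R: Vector_Spaces.linear scl "(*)" "\<lambda>y. B x y" for x
    by (rule linear_right)
  obtain h where "antiderivative w h"
    using antiderivative_exists[OF w] by blast
  moreover obtain g where "h = rotate1 g"
    using surjD[OF surj_rotate1] by blast
  ultimately have g: "antiderivative w (rotate1 g)"
    by simp
  have len: "length v = ?n" "length w = ?n" "length g = ?n"
    using v w g by (auto simp: Kspace_def antiderivative_rotate1_right_iff)
  have edges: "B (v ! i) (rotate1 g ! i) = B (v ! i) (g ! i)" if i: "i < ?n" for i
  proof -
    have "rotate1 g ! i - g ! i = w ! i"
      using g i by (simp add: antiderivative_rotate1_right_iff nth_rotate1 len)
    moreover have "B (v ! i) (w ! i) = 0"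
      using isotropic[of "ms ! i"] v w i by (auto simp: Kspace_def)
    ultimately show ?thesis
      using R.diff[of "v ! i" "rotate1 g ! i" "g ! i"] by simp
  qed
  have "qform B (rev v) (rev w) = (\<Sum>i<?n. B (rev v ! i) (rev (map uminus g) ! i))"
    using qform_eq[of "rev v" "rev ms"] v w antiderivative_rev[OF g]
    by (simp add: rev_in_Kspace_iff)
  also have "\<dots> = (\<Sum>i<?n. - B (v ! (?n - Suc i)) (g ! (?n - Suc i)))"
    by (intro sum.cong) (auto simp: rev_nth len R.neg)
  also have "\<dots> = - (\<Sum>i<?n. B (v ! i) (g ! i))"
    by (subst sum.nat_diff_reindex) (simp add: sum_negf)
  also have "\<dots> = - (\<Sum>i<?n. B (v ! i) (rotate1 g ! i))"
    by (simp add: edges)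
  also have "\<dots> = - qform B v w"
    using qform_eq[OF v w g] by simp
  finally show ?thesis .
qed

end

theorem proposition5:
  fixes scl :: "'f::field \<Rightarrow> 'v::ab_group_add \<Rightarrow> 'v"
    and B :: "'v \<Rightarrow> 'v \<Rightarrow> 'f"
    and l :: "nat \<Rightarrow> 'v set"
    and n :: nat
  assumes "CHAR('f) \<noteq> 2"
    and "symplectic_vector_space scl B"
    and "n \<ge> 2"
    and "\<And>i. i \<in> {1..n} \<Longrightarrow> lagrangian scl B (l i)"
  shows "bij_betw rotate1 (Kspace (map l [1..<n+1])) (Kspace (map l ([2..<n+1] @ [1]))) \<and>
         bij_betw rev (Kspace (map l [1..<n+1])) (Kspace (map l (rev [1..<n+1]))) \<and>
         (\<forall>v \<in> Kspace (map l [1..<n+1]). \<forall>w \<in> Kspace (map l [1..<n+1]).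
            qform B (rotate1 v) (rotate1 w) = qform B v w \<and>
            qform B v w = - qform B (rev v) (rev w))"
proof -
  interpret symplectic_vector_space scl B
    by fact
  let ?ms = "map l [1..<n+1]"
  have "[1..<n+1] = 1 # [2..<n+1]"
    using assms(3) upt_conv_Cons[of 1 "n+1"] by (simp add: numeral_2_eq_2)
  then have rotate: "map l ([2..<n+1] @ [1]) = rotate1 ?ms"
    by simp
  have isotropic: "B x y = 0" if "L \<in> set ?ms" "x \<in> L" "y \<in> L" for L x y
    using that assms(4) by (force intro: lagrangian_isotropic)
  have "bij_betw rotate1 (Kspace ?ms) (Kspace (map l ([2..<n+1] @ [1])))"
    unfolding rotate by (rule bij_betw_rotate1_Kspace)
  moreover have "bij_betw rev (Kspace ?ms) (Kspace (map l (rev [1..<n+1])))"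
    unfolding rev_map[symmetric] by (rule bij_betw_rev_Kspace)
  moreover have "qform B (rotate1 v) (rotate1 w) = qform B v w"
    and "qform B v w = - qform B (rev v) (rev w)"
    if "v \<in> Kspace ?ms" "w \<in> Kspace ?ms" for v w
    using qform_rotate1[OF that] qform_rev[OF that isotropic] by simp_all
  ultimately show ?thesis
    by blast
qed

end
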